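(* Let $\mathcal{X}$ be a measurable space, let $P$ be a probability measure on $\mathcal{X}$, and let $\{f_m, m \in \mathcal{M}\}$ be a finite collection of real-valued measurable functions on $\mathcal{X}$ with $|\mathcal{M}| \geq 2$. Let $\xi_1, \ldots, \xi_n$ ($n \geq 1$) be i.i.d. random variables with common distribution $P$, and let $P_n$ denote the empirical probability measure based on $\xi_1, \ldots, \xi_n$. Assume that $|f_m - f_{m'}| \leq 1$ for every $m, m' \in \mathcal{M}$, and that $P f_m \geq 0$ for every $m \in \mathcal{M}$. Let $\varphi$ be a convex function on $[0, +\infty)$ with $\varphi(0) = 0$ and such that $x \mapsto \varphi(x)/x^2$ is nondecreasing, and let $\varphi^*$ denote the convex conjugate of $\varphi$. Assume that $$P f_m \geq \varphi\left(\sqrt{P f_m^2}\right) \qquad \text{for every } m \in \mathcal{M}.$$ Let $\widehat{m}$ be an $\mathcal{M}$-valued random variable such that $$P_n f_{\widehat{m}} = \inf_{m \in \mathcal{M}} P_n f_m .$$ Then for every $\varepsilon \in (0,1)$, setting $C_\varepsilon = \frac{1+\varepsilon}{1-\varepsilon}$ and $C'_\varepsilon = (1-\varepsilon)^{-1}$, for every real number $x > 0$, $$\mathbb{P}\left[P f_{\widehat{m}} > C_\varepsilon \inf_{m \in \mathcal{M}} P f_m + C'_\varepsilon (x + \ln|\mathcal{M}|)\left(\frac{4}{\varepsilon}\varphi^*\left(\frac{1}{\sqrt{n}}\right) + \frac{1}{3n}\right)\right] \leq e^{-x}.$$ In particular, for every $\varepsilon \in (0,1)$, $$\mathbb{E}[P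 f_{\widehat{m}}] \leq C_\varepsilon \inf_{m \in \mathcal{M}} \mathbb{E}[P f_m] + C'_\varepsilon \ln(e|\mathcal{M}|)\left(\frac{4}{\varepsilon}\varphi^*\left(\frac{1}{\sqrt{n}}\right) + \frac{1}{3n}\right).$$
   Context: For a measurable function $f$ on $\mathcal{X}$, $P f = \int f \, dP$ and $P_n f = \frac{1}{n}\sum_{i=1}^n f(\xi_i)$. The hypothesis relating $P f_m$ and $P f_m^2$ implicitly includes that $P f_m^2 < \infty$ for every $m$. $P f_{\widehat{m}}$ denotes the random variable obtained by evaluating the deterministic map $m \mapsto P f_m$ at $m = \widehat{m}$. The convex conjugate is $\varphi^*(y) = \sup_{x \geq 0}\,(xy - \varphi(x)) \in (-\infty, +\infty]$. If $\varphi^*(1/\sqrt{n}) = +\infty$ the right-hand sides are $+\infty$. Since the $f_m$ are nonrandom, $\mathbb{E}[P f_m] = P f_m$. *)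

theory Defs
  imports "HOL-Probability.Probability"
begin

text \<open>Conjugate of a function on the half-line: values of \<open>\<phi>\<close> at negative arguments play no role.\<close>

definition convex_conjugate :: "(real \<Rightarrow> real) \<Rightarrow> real \<Rightarrow> ereal" where
  "convex_conjugate \<phi> y = (SUP x\<in>{0..}. ereal (x * y - \<phi> x))"

definition empirical_mean :: "nat \<Rightarrow> (nat \<Rightarrow> 'w \<Rightarrow> 'x) \<Rightarrow> ('x \<Rightarrow> real) \<Rightarrow> 'w \<Rightarrow> real" where
  "empirical_mean n \<xi> g \<omega> = (1 / real n) * (\<Sum>i=1..n. g (\<xi> i \<omega>))"

end

theory Submission
  imports Defs
begin

text \<open>
  Let \<open>m0\<close> minimise \<open>P f\<^sub>m\<close>. Bernstein's inequality for \<open>f\<^bsub>m0\<^esub> - f\<^sub>m\<close> and a union bound over \<open>m\<close> show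
  that, with probability at least \<open>1 - exp (- x)\<close> and \<open>y = x + ln |I|\<close>, the excess of the selected
  \<open>m\<close> over \<open>m0\<close> is at most \<open>(\<parallel>f\<^bsub>m0\<^esub>\<parallel> + \<parallel>f\<^sub>m\<parallel>) sqrt (2 y / n) + y / (3 n)\<close> in \<open>L\<^sup>2(P)\<close> norms.
  As \<open>\<phi> (\<theta> u) \<le> \<theta>\<^sup>2 \<phi> u\<close> for \<open>\<theta> \<le> 1\<close>, the Fenchel-Young inequality at \<open>\<theta> \<parallel>f\<^sub>m\<parallel>\<close> with
  \<open>\<theta> = \<epsilon> / sqrt (2 y)\<close> absorbs each norm into \<open>\<epsilon> P f\<^sub>m\<close> plus a multiple of the conjugate. Integrating
  the exponential tail gives the bound in expectation.
\<close>

section \<open>Exponential moments of bounded variables\<close>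

text \<open>Passing from \<open>n\<close> to \<open>n + 1\<close> multiplies the factorial by
  \<open>n + 3\<close>, which is at least 3. This is the source of the constant 3 in Bernstein's
  inequality.\<close>

lemma fact_ge_two_three_power: "2 * 3 ^ n \<le> (fact (n + 2) :: real)"
proof (induction n)
  case (Suc n)
  have "2 * 3 ^ Suc n \<le> real (n + 3) * (2 * 3 ^ n)" by (simp add: algebra_simps)
  also have "\<dots> \<le> real (n + 3) * fact (n + 2)"
    by (rule mult_left_mono[OF Suc.IH]) simp
  also have "\<dots> = fact (Suc n + 2)" by (simp add: algebra_simps)
  finally show ?case .
qed (simp add: numeral_2_eq_2)

text \<open>From the quadratic term on, the exponential series is dominated termwise by a geometric
  series of ratio \<open>c / 3\<close>.\<close>

lemma exp_le_quadratic_geometric: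
  fixes u c :: real
  assumes "\<bar>u\<bar> \<le> c" "c < 3"
  shows "exp u \<le> 1 + u + u\<^sup>2 / (2 * (1 - c / 3))"
proof -
  have s1: "summable (\<lambda>n. inverse (fact (n + 2)) *\<^sub>R u ^ (n + 2))"
    using summable_ignore_initial_segment[OF summable_exp_generic[of u], of 2] by (simp add: divide_inverse)
  have s2: "(\<lambda>n. u\<^sup>2 / 2 * (c / 3) ^ n) sums (u\<^sup>2 / 2 * (1 / (1 - c / 3)))"
    using assms by (intro sums_mult geometric_sums) auto
  have "inverse (fact (n + 2)) *\<^sub>R u ^ (n + 2) \<le> u\<^sup>2 / 2 * (c / 3) ^ n" for n
  proof -
    have "inverse (fact (n + 2)) * u ^ (n + 2) \<le> \<bar>u\<bar> ^ (n + 2) / fact (n + 2)"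
      by (simp add: divide_inverse mult.commute power_abs[symmetric] del: fact_Suc power_Suc add_2_eq_Suc')
    also have "\<dots> \<le> \<bar>u\<bar> ^ (n + 2) / (2 * 3 ^ n)"
      by (intro divide_left_mono fact_ge_two_three_power) auto
    also have "\<dots> = u\<^sup>2 / 2 * (\<bar>u\<bar> / 3) ^ n"
      by (simp add: power_add power_divide power2_eq_square[symmetric])
    also have "\<dots> \<le> u\<^sup>2 / 2 * (c / 3) ^ n"
      using assms by (intro mult_left_mono power_mono) auto
    finally show ?thesis by simp
  qed
  then have "(\<Sum>n. inverse (fact (n + 2)) *\<^sub>R u ^ (n + 2)) \<le> u\<^sup>2 / 2 * (1 / (1 - c / 3))"
    using suminf_le[OF _ s1 sums_summable[OF s2]] sums_unique[OF s2] by auto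
  then show ?thesis using exp_first_two_terms[of u] by simp
qed

text \<open>The quadratic bound on \<open>exp\<close> with \<open>c = l\<close> is integrated, then
  \<open>1 + t \<le> exp t\<close> is applied. \<open>X\<close> is not centred: the raw second
  moment takes the place of the variance, so that the bound 1 on \<open>X\<close> itself can be
  used.\<close>

lemma (in prob_space) mgf_le_exp_quadratic:
  fixes X :: "'a \<Rightarrow> real"
  assumes [measurable]: "X \<in> borel_measurable M"
    and bd: "\<And>y. y \<in> space M \<Longrightarrow> \<bar>X y\<bar> \<le> 1"
    and l: "0 \<le> l" "l < 3"
    and v: "expectation (\<lambda>y. (X y)\<^sup>2) \<le> v"
  shows "integrable M (\<lambda>y. exp (l * X y))"
    and "expectation (\<lambda>y. exp (l * X y)) \<le> exp (l * expectation X + l\<^sup>2 * v / (2 * (1 - l / 3)))"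
proof -
  have i1: "integrable M X"
    using bd by (intro integrable_const_bound[of _ 1] AE_I2) auto
  have i2: "integrable M (\<lambda>y. (X y)\<^sup>2)"
    using bd by (intro integrable_const_bound[of _ 1] AE_I2) (auto simp: abs_square_le_1)
  have le: "l * X y \<le> l" "\<bar>l * X y\<bar> \<le> l" if "y \<in> space M" for y
    using bd[OF that] l(1) by (auto simp: abs_mult mult_left_le abs_le_iff)
  show i3: "integrable M (\<lambda>y. exp (l * X y))"
    using le by (intro integrable_const_bound[of _ "exp l"] AE_I2) auto
  let ?q = "2 * (1 - l / 3)"
  have "expectation (\<lambda>y. exp (l * X y)) \<le> expectation (\<lambda>y. 1 + l * X y + (l\<^sup>2 / ?q) * (X y)\<^sup>2)"
    using i1 i2 i3 exp_le_quadratic_geometric[OF le(2) l(2)]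
    by (intro integral_mono) (auto simp: power_mult_distrib)
  also have "\<dots> = 1 + (l * expectation X + (l\<^sup>2 / ?q) * expectation (\<lambda>y. (X y)\<^sup>2))"
    using i1 i2 by (simp add: prob_space)
  also have "\<dots> \<le> 1 + (l * expectation X + (l\<^sup>2 / ?q) * v)"
    using l v by (intro add_left_mono mult_left_mono) auto
  also have "\<dots> \<le> exp (l * expectation X + (l\<^sup>2 / ?q) * v)"
    by (rule exp_ge_add_one_self)
  finally show "expectation (\<lambda>y. exp (l * X y)) \<le> exp (l * expectation X + l\<^sup>2 * v / ?q)"
    by simp
qed

section \<open>Deviations of the empirical mean\<close>

lemma borel_measurable_empirical_mean [measurable (raw)]:
  assumes "g \<in> borel_measurable P" "\<And>i. i \<in> {1..n} \<Longrightarrow> \<xi> i \<in> measurable M P"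
  shows "empirical_mean n \<xi> g \<in> borel_measurable M"
  unfolding empirical_mean_def[abs_def]
  using assms by (intro borel_measurable_times borel_measurable_sum measurable_const) (auto intro: measurable_compose)

text \<open>Exponential Markov inequality at rate \<open>n * l\<close>. This rate cancels the
  \<open>1 / n\<close> of the empirical mean, so the exponential is a product of independent factors
  and its expectation is an \<open>n\<close>-th power.\<close>

lemma (in prob_space) chernoff_empirical_mean:
  fixes X :: "'b \<Rightarrow> real"
  assumes P: "prob_space P"
    and n: "n \<ge> 1"
    and ind: "indep_vars (\<lambda>_. P) \<xi> {1..n}"
    and dist: "\<And>i. i \<in> {1..n} \<Longrightarrow> distr M P (\<xi> i) = P"
    and [measurable]: "X \<in> borel_measurable P"
    and bd: "\<And>y. y \<in> space P \<Longrightarrow> \<bar>X y\<bar> \<le> 1"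
    and l: "0 < l" "l < 3"
    and v: "(\<integral>y. (X y)\<^sup>2 \<partial>P) \<le> v"
  shows "prob {\<omega>\<in>space M. empirical_mean n \<xi> X \<omega> \<ge> (\<integral>y. X y \<partial>P) + t}
           \<le> exp (- real n * (l * t - l\<^sup>2 * v / (2 * (1 - l / 3))))"
proof -
  interpret P: prob_space P by fact
  have \<xi>: "\<xi> i \<in> measurable M P" if "i \<in> {1..n}" for i
    using ind that by (auto simp: indep_vars_def)
  define Y where "Y i \<omega> = exp (l * X (\<xi> i \<omega>))" for i \<omega>
  have indY: "indep_vars (\<lambda>_. borel) Y {1..n}"
    unfolding Y_def by (rule indep_vars_compose2[OF ind]) measurable
  have intY: "integrable M (Y i)" if "i \<in> {1..n}" for i
    using P.mgf_le_exp_quadratic(1)[of X l, OF _ bd] l v dist[OF that]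
      integrable_distr[OF \<xi>[OF that], of "\<lambda>y. exp (l * X y)"]
    by (auto simp: Y_def[abs_def])
  have eY: "expectation (Y i) = (\<integral>y. exp (l * X y) \<partial>P)" if "i \<in> {1..n}" for i
    using integral_distr[OF \<xi>[OF that], of "\<lambda>y. exp (l * X y)"] dist[OF that]
    by (simp add: Y_def[abs_def])
  let ?\<mu> = "\<integral>y. X y \<partial>P" and ?k = "real n * l"
  have prodY: "exp (?k * empirical_mean n \<xi> X \<omega>) = (\<Prod>i\<in>{1..n}. Y i \<omega>)" for \<omega>
    using n by (simp add: empirical_mean_def Y_def exp_sum[symmetric] sum_distrib_left[symmetric])
  have "prob {\<omega>\<in>space M. empirical_mean n \<xi> X \<omega> \<ge> ?\<mu> + t}
      \<le> exp (- ?k * (?\<mu> + t)) * (\<integral>\<omega>\<in>space M. exp (?k * empirical_mean n \<xi> X \<omega>) \<partial>M)"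
    using n l indep_vars_integrable[OF _ indY intY]
    by (intro Chernoff_ineq_ge)
      (auto simp: prodY set_integrable_def intro!: integrable_mult_indicator[where 'b=real, simplified])
  also have "(\<integral>\<omega>\<in>space M. exp (?k * empirical_mean n \<xi> X \<omega>) \<partial>M) = expectation (\<lambda>\<omega>. \<Prod>i\<in>{1..n}. Y i \<omega>)"
    by (simp add: prodY set_lebesgue_integral_def cong: Bochner_Integration.integral_cong)
  also have "\<dots> = (\<Prod>i\<in>{1..n}. expectation (Y i))"
    by (rule indep_vars_lebesgue_integral[OF _ indY intY]) simp
  also have "\<dots> = (\<integral>y. exp (l * X y) \<partial>P) ^ n"
    by (simp add: eY)
  also have "\<dots> \<le> exp (l * ?\<mu> + l\<^sup>2 * v / (2 * (1 - l / 3))) ^ n"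
    using l by (intro power_mono P.mgf_le_exp_quadratic(2) bd v) (auto intro!: integral_nonneg_AE)
  also have "exp (- ?k * (?\<mu> + t)) * \<dots> = exp (- real n * (l * t - l\<^sup>2 * v / (2 * (1 - l / 3))))"
    unfolding exp_of_nat_mult[symmetric] exp_add[symmetric] by (simp add: algebra_simps)
  finally show ?thesis by simp
qed

text \<open>The Chernoff bound at a well-chosen rate \<open>l\<close>. Here \<open>\<sigma>\<close>
  is an upper bound for the norm of \<open>X\<close> in L2 rather than the norm itself, so that a
  sum of two norms can be inserted.\<close>

lemma (in prob_space) bernstein_empirical_mean:
  fixes X :: "'b \<Rightarrow> real"
  assumes P: "prob_space P"
    and n: "n \<ge> 1"
    and ind: "indep_vars (\<lambda>_. P) \<xi> {1..n}"
    and dist: "\<And>i. i \<in> {1..n} \<Longrightarrow> distr M P (\<xi> i) = P"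
    and X: "X \<in> borel_measurable P"
    and bd: "\<And>y. y \<in> space P \<Longrightarrow> \<bar>X y\<bar> \<le> 1"
    and \<sigma>: "(\<integral>y. (X y)\<^sup>2 \<partial>P) \<le> \<sigma>\<^sup>2" "0 \<le> \<sigma>"
    and y: "0 < y"
  shows "prob {\<omega>\<in>space M. empirical_mean n \<xi> X \<omega>
                \<ge> (\<integral>y. X y \<partial>P) + (\<sigma> * sqrt (2 * y / n) + y / (3 * n))} \<le> exp (- y)"
    (is "prob ?E \<le> _")
proof -
  define s where "s = y / n"
  have s: "0 < s" "y = n * s" using y n by (auto simp: s_def)
  define t where "t = \<sigma> * sqrt (2 * y / n) + y / (3 * n)"
  have t: "t = \<sigma> * sqrt (2 * s) + s / 3" by (simp add: s_def t_def)
  note ch = chernoff_empirical_mean[OF P n ind dist X bd _ _ \<sigma>(1), of _ t, folded t_def]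
  show ?thesis
  proof (cases "\<sigma> = 0")
    case True
    have "prob ?E \<le> exp (- real n * (l * (s / 3)))" if "l \<in> {0<..<3}" for l
      using ch[of l] that True by (simp add: t_def s_def)
    \<comment> \<open>The exponent improves as \<open>l\<close> grows and equals \<open>- y\<close>
      at the excluded rate 3, so the bound is obtained as a limit from the left.\<close>
    then have "eventually (\<lambda>l. prob ?E \<le> exp (- real n * (l * (s / 3)))) (at_left 3)"
      by (intro eventually_at_leftI[of 0]) auto
    moreover have "((\<lambda>l. exp (- real n * (l * (s / 3)))) \<longlongrightarrow> exp (- real n * (3 * (s / 3)))) (at_left 3)"
      by (intro tendsto_intros)
    ultimately have "prob ?E \<le> exp (- real n * (3 * (s / 3)))"
      by (intro tendsto_lowerbound[of _ _ "at_left 3"]) auto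
    then show ?thesis by (simp add: s)
  next
    case False
    with \<sigma> have \<sigma>: "0 < \<sigma>" by simp
    \<comment> \<open>\<open>l\<close> solves \<open>l / (1 - l / 3) = \<mu>\<close>, which makes the exponent exactly \<open>- y\<close>.\<close>
    define \<mu> where "\<mu> = sqrt (2 * s) / \<sigma>"
    have \<mu>: "0 < \<mu>" "sqrt (2 * s) = \<mu> * \<sigma>" using \<sigma> s by (auto simp: \<mu>_def)
    have s\<mu>: "s = \<mu>\<^sup>2 * \<sigma>\<^sup>2 / 2"
      using arg_cong[OF \<mu>(2), of "\<lambda>z. z\<^sup>2"] s by (simp add: power_mult_distrib)
    define l where "l = \<mu> / (1 + \<mu> / 3)"
    have l: "0 < l" "l < 3" using \<mu> by (auto simp: l_def field_simps)
    have q: "1 - l / 3 = 1 / (1 + \<mu> / 3)" using \<mu> by (simp add: l_def field_simps)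
    have lp: "l * (1 + \<mu> / 3) = \<mu>" using \<mu> by (simp add: l_def)
    have "l\<^sup>2 * \<sigma>\<^sup>2 / (2 * (1 - l / 3)) = l * \<sigma>\<^sup>2 / 2 * (l * (1 + \<mu> / 3))"
      by (simp add: q power2_eq_square)
    then have "l * t - l\<^sup>2 * \<sigma>\<^sup>2 / (2 * (1 - l / 3)) = l * (t - \<sigma>\<^sup>2 * \<mu> / 2)"
      unfolding lp by (simp add: algebra_simps)
    \<comment> \<open>Since \<open>s = \<mu>\<^sup>2 * \<sigma>\<^sup>2 / 2\<close>, the deviation
      is \<open>t = \<sigma>\<^sup>2 * \<mu> + \<sigma>\<^sup>2 * \<mu>\<^sup>2 / 6\<close>. A
      factor \<open>1 + \<mu> / 3\<close> splits off, which is the denominator of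
      \<open>l\<close>.\<close>
    also have "t - \<sigma>\<^sup>2 * \<mu> / 2 = \<sigma>\<^sup>2 * \<mu> / 2 * (1 + \<mu> / 3)"
      unfolding t[unfolded \<mu>(2)] s\<mu> by (simp add: power2_eq_square field_simps)
    also have "l * \<dots> = s"
    proof -
      have "l * (\<sigma>\<^sup>2 * \<mu> / 2 * (1 + \<mu> / 3)) = \<sigma>\<^sup>2 * \<mu> / 2 * (l * (1 + \<mu> / 3))"
        by (simp only: mult_ac)
      then show ?thesis unfolding lp by (simp add: s\<mu> power2_eq_square)
    qed
    finally show ?thesis using ch[of l] l by (simp add: t_def s)
  qed
qed

section \<open>Norm, conjugacy and tail inequalities\<close>

text \<open>Minkowski's inequality, by integrating a weighted pointwise bound on the square of the
  difference; the weights \<open>a\<close> and \<open>b\<close> are the two norms up to a small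
  margin.\<close>

lemma (in prob_space) L2_norm_diff_le:
  fixes f g :: "'a \<Rightarrow> real"
  assumes [measurable]: "f \<in> borel_measurable M" "g \<in> borel_measurable M"
    and i: "integrable M (\<lambda>y. (f y)\<^sup>2)" "integrable M (\<lambda>y. (g y)\<^sup>2)"
  shows "sqrt (expectation (\<lambda>y. (f y - g y)\<^sup>2))
           \<le> sqrt (expectation (\<lambda>y. (f y)\<^sup>2)) + sqrt (expectation (\<lambda>y. (g y)\<^sup>2))"
    (is "_ \<le> ?A + ?B")
proof (rule field_le_epsilon)
  fix e :: real assume e: "0 < e"
  \<comment> \<open>The margin \<open>e / 2\<close> keeps both weights positive when a norm
    vanishes; the two margins add up to the allowed slack \<open>e\<close>.\<close>
  define a b where "a = ?A + e / 2" and "b = ?B + e / 2"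
  have ab: "0 < a" "0 < b" using e by (auto simp: a_def b_def add_nonneg_pos)
  have sq: "expectation (\<lambda>y. (f y)\<^sup>2) \<le> a\<^sup>2" "expectation (\<lambda>y. (g y)\<^sup>2) \<le> b\<^sup>2"
    using e by (auto intro!: sqrt_le_D simp: a_def b_def)
  have "(f y - g y)\<^sup>2 \<le> (1 + b / a) * (f y)\<^sup>2 + (1 + a / b) * (g y)\<^sup>2" for y
  proof -
    have "0 \<le> (b * f y + a * g y)\<^sup>2 / (a * b)" using ab by simp
    also have "\<dots> = (1 + b / a) * (f y)\<^sup>2 + (1 + a / b) * (g y)\<^sup>2 - (f y - g y)\<^sup>2"
      using ab by (simp add: power2_eq_square field_simps)
    finally show ?thesis by simp
  qed
  then have "expectation (\<lambda>y. (f y - g y)\<^sup>2)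
      \<le> expectation (\<lambda>y. (1 + b / a) * (f y)\<^sup>2 + (1 + a / b) * (g y)\<^sup>2)"
    using i ab by (intro integral_mono') auto
  also have "\<dots> = (1 + b / a) * expectation (\<lambda>y. (f y)\<^sup>2) + (1 + a / b) * expectation (\<lambda>y. (g y)\<^sup>2)"
    using i by simp
  also have "\<dots> \<le> (1 + b / a) * a\<^sup>2 + (1 + a / b) * b\<^sup>2"
    using ab sq by (intro add_mono mult_left_mono) auto
  also have "\<dots> = (a + b)\<^sup>2" using ab by (simp add: power2_eq_square field_simps)
  finally show "sqrt (expectation (\<lambda>y. (f y - g y)\<^sup>2)) \<le> ?A + ?B + e"
    using real_sqrt_le_mono ab by (fastforce simp: a_def b_def)
qed

text \<open>Young's inequality at \<open>\<theta> * u\<close>, divided by \<open>\<theta>\<close>.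
  The monotone ratio makes \<open>\<phi>\<close> shrink at least quadratically under scaling, so a
  factor \<open>\<theta>\<close> remains on \<open>p\<close> after the division.\<close>

lemma convex_conjugate_scaled_young:
  assumes \<phi>0: "\<phi> 0 = 0" and mono: "mono_on {0<..} (\<lambda>x. \<phi> x / x\<^sup>2)"
    and u: "0 \<le> u" "\<phi> u \<le> p" and k: "convex_conjugate \<phi> z = ereal k"
    and th: "0 < \<theta>" "\<theta> \<le> 1"
  shows "u * z \<le> \<theta> * p + k / \<theta>"
proof -
  have "\<phi> (\<theta> * u) \<le> \<theta>\<^sup>2 * \<phi> u"
  proof (cases "u = 0")
    case False
    with u th have "\<phi> (\<theta> * u) / (\<theta> * u)\<^sup>2 \<le> \<phi> u / u\<^sup>2"
      by (intro mono_onD[OF mono]) (auto simp: mult_left_le_one_le)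
    with False u th show ?thesis by (simp add: field_simps power_mult_distrib)
  qed (simp add: \<phi>0)
  also have "\<dots> \<le> \<theta>\<^sup>2 * p" using u by (intro mult_left_mono) auto
  finally have *: "\<phi> (\<theta> * u) \<le> \<theta>\<^sup>2 * p" .
  have "ereal (\<theta> * u * z - \<phi> (\<theta> * u)) \<le> convex_conjugate \<phi> z"
    unfolding convex_conjugate_def using u th by (intro SUP_upper) auto
  with * have "\<theta> * (u * z) \<le> \<theta> * (\<theta> * p + k / \<theta>)"
    using th by (simp add: k algebra_simps power2_eq_square)
  then show ?thesis using th by simp
qed

lemma convex_conjugate_nonneg: "\<phi> 0 = 0 \<Longrightarrow> 0 \<le> convex_conjugate \<phi> z"
  unfolding convex_conjugate_def by (rule SUP_upper2[of 0]) auto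

text \<open>Layer-cake formula: the positive part of \<open>Z\<close> is the length of the set of
  \<open>x > 0\<close> below \<open>Z\<close>. Exchanging the integrals leaves the tail
  probabilities, and \<open>exp (- x)\<close> integrates to 1.\<close>

lemma (in prob_space) expectation_le_1_of_exp_tail:
  fixes Z :: "'a \<Rightarrow> real"
  assumes [measurable]: "Z \<in> borel_measurable M" and i: "integrable M Z"
    and tail: "\<And>x. 0 < x \<Longrightarrow> prob {\<omega>\<in>space M. x < Z \<omega>} \<le> exp (- x)"
  shows "expectation Z \<le> 1"
proof -
  interpret pair_sigma_finite lborel M ..
  have "(\<integral>\<^sup>+\<omega>. ennreal (Z \<omega>) \<partial>M) = (\<integral>\<^sup>+\<omega>. (\<integral>\<^sup>+x. indicator {0<..} x * indicator {..<Z \<omega>} x \<partial>lborel) \<partial>M)"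
  proof (intro nn_integral_cong)
    fix \<omega>
    have "(\<integral>\<^sup>+x. indicator {0<..} x * indicator {..<Z \<omega>} x \<partial>lborel) = (\<integral>\<^sup>+x. indicator {0<..<Z \<omega>} x \<partial>lborel)"
      by (intro nn_integral_cong) (auto simp: indicator_def)
    then show "ennreal (Z \<omega>) = (\<integral>\<^sup>+x. indicator {0<..} x * indicator {..<Z \<omega>} x \<partial>lborel)"
      by (cases "0 \<le> Z \<omega>") (auto simp: ennreal_neg)
  qed
  also have "\<dots> = (\<integral>\<^sup>+x. (\<integral>\<^sup>+\<omega>. indicator {0<..} x * indicator {..<Z \<omega>} x \<partial>M) \<partial>lborel)"
    by (rule Fubini') (simp add: indicator_def[abs_def] split_beta, measurable)
  \<comment> \<open>The factor \<open>x ^ 0\<close> brings the integrand into the form of the Gamma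
    integral, here with value \<open>fact 0 = 1\<close>.\<close>
  also have "\<dots> \<le> (\<integral>\<^sup>+x. ennreal (x ^ 0 * exp (- x)) * indicator {0 ..} x \<partial>lborel)"
  proof (intro nn_integral_mono)
    fix x :: real
    have "(\<integral>\<^sup>+\<omega>. indicator {..<Z \<omega>} x \<partial>M) = (\<integral>\<^sup>+\<omega>. indicator {\<omega>\<in>space M. x < Z \<omega>} \<omega> \<partial>M)"
      by (intro nn_integral_cong) (auto simp: indicator_def)
    also have "\<dots> = ennreal (prob {\<omega>\<in>space M. x < Z \<omega>})"
      by (simp add: emeasure_eq_measure)
    finally have "(\<integral>\<^sup>+\<omega>. indicator {..<Z \<omega>} x \<partial>M) = ennreal (prob {\<omega>\<in>space M. x < Z \<omega>})" .
    then show "(\<integral>\<^sup>+\<omega>. indicator {0<..} x * indicator {..<Z \<omega>} x \<partial>M)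
        \<le> ennreal (x ^ 0 * exp (- x)) * indicator {0 ..} x"
      using tail[of x] by (auto simp: indicator_def ennreal_leI)
  qed
  also have "\<dots> = 1" by (subst nn_intergal_power_times_exp_Ici) simp
  finally have "(\<integral>\<^sup>+\<omega>. ennreal (Z \<omega>) \<partial>M) \<le> 1" .
  moreover have "expectation Z \<le> enn2real (\<integral>\<^sup>+\<omega>. ennreal (Z \<omega>) \<partial>M)"
    by (simp add: real_lebesgue_integral_def[OF i])
  ultimately show ?thesis
    using enn2real_leI[of 1] by force
qed

section \<open>Risk bounds for the selected index\<close>

theorem theorem1:
  fixes P :: "'x measure"
    and \<Omega> :: "'w measure"
    and I :: "'m set"
    and f :: "'m \<Rightarrow> 'x \<Rightarrow> real"
    and n :: nat
    and \<xi> :: "nat \<Rightarrow> 'w \<Rightarrow> 'x"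
    and \<phi> :: "real \<Rightarrow> real"
    and mhat :: "'w \<Rightarrow> 'm"
  assumes "prob_space P"
    and "prob_space \<Omega>"
    and "finite I" and "card I \<ge> 2"
    and "\<And>m. m \<in> I \<Longrightarrow> f m \<in> borel_measurable P"
    and "n \<ge> 1"
    and "prob_space.indep_vars \<Omega> (\<lambda>_. P) \<xi> {1..n}"
    and "\<And>i. i \<in> {1..n} \<Longrightarrow> distr \<Omega> P (\<xi> i) = P"
    and "\<And>m m' y. m \<in> I \<Longrightarrow> m' \<in> I \<Longrightarrow> y \<in> space P \<Longrightarrow> \<bar>f m y - f m' y\<bar> \<le> 1"
    and "\<And>m. m \<in> I \<Longrightarrow> integrable P (\<lambda>y. (f m y)\<^sup>2)"
    and "\<And>m. m \<in> I \<Longrightarrow> integral\<^sup>L P (f m) \<ge> 0"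
    and "convex_on {0..} \<phi>"
    and "\<phi> 0 = 0"
    and "mono_on {0<..} (\<lambda>x. \<phi> x / x\<^sup>2)"
    and "\<And>m. m \<in> I \<Longrightarrow>
           integral\<^sup>L P (f m) \<ge> \<phi> (sqrt (integral\<^sup>L P (\<lambda>y. (f m y)\<^sup>2)))"
    and "mhat \<in> measurable \<Omega> (count_space I)"
    and "AE \<omega> in \<Omega>. empirical_mean n \<xi> (f (mhat \<omega>)) \<omega>
                     = (INF m\<in>I. empirical_mean n \<xi> (f m) \<omega>)"
  shows "(\<forall>\<epsilon>\<in>{0<..<1::real}. \<forall>x>0::real.
            \<P>(\<omega> in \<Omega>. ereal (integral\<^sup>L P (f (mhat \<omega>)))
                > ereal ((1 + \<epsilon>) / (1 - \<epsilon>) * (INF m\<in>I. integral\<^sup>L P (f m)))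
                  + ereal (1 / (1 - \<epsilon>) * (x + ln (real (card I))))
                    * (ereal (4 / \<epsilon>) * convex_conjugate \<phi> (1 / sqrt (real n))
                       + ereal (1 / (3 * real n))))
            \<le> exp (- x))
       \<and> (\<forall>\<epsilon>\<in>{0<..<1::real}.
            ereal (prob_space.expectation \<Omega> (\<lambda>\<omega>. integral\<^sup>L P (f (mhat \<omega>))))
            \<le> ereal ((1 + \<epsilon>) / (1 - \<epsilon>)
                * (INF m\<in>I. prob_space.expectation \<Omega> (\<lambda>_. integral\<^sup>L P (f m))))
              + ereal (1 / (1 - \<epsilon>) * ln (exp 1 * real (card I)))
                * (ereal (4 / \<epsilon>) * convex_conjugate \<phi> (1 / sqrt (real n))
                   + ereal (1 / (3 * real n))))"
proof -
  interpret P: prob_space P by fact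
  interpret prob_space \<Omega> by fact
  note fin = assms(3) and fm = assms(5) and n = assms(6) and ind = assms(7) and dist = assms(8)
    and bd = assms(9) and sqi = assms(10) and \<phi>0 = assms(13) and mono = assms(14)
    and \<phi>R = assms(15) and mhat = assms(16)
  define R where "R m = integral\<^sup>L P (f m)" for m
  define z where "z = 1 / sqrt (real n)"
  define L where "L = ln (real (card I))"
  have ne: "I \<noteq> {}" using assms(4) by auto
  have fi: "integrable P (f m)" if "m \<in> I" for m
    using P.square_integrable_imp_integrable[OF fm sqi] that by simp
  have "1 / 2 \<le> ln (2 :: real)" using ln2_ge_two_thirds by simp
  also have "ln 2 \<le> L" using assms(4) by (simp add: L_def)
  finally have L: "1 / 2 \<le> L" .
  have "Inf (R ` I) \<in> R ` I" using fin ne by (simp add: cInf_eq_Min)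
  then obtain m0 where m0: "m0 \<in> I" "(INF m\<in>I. R m) = R m0" by auto
  have mhatI: "mhat \<omega> \<in> I" if "\<omega> \<in> space \<Omega>" for \<omega>
    using measurable_space[OF mhat that] by simp
  have Rm [measurable]: "(\<lambda>\<omega>. R (mhat \<omega>)) \<in> borel_measurable \<Omega>"
    by (rule measurable_compose[OF mhat]) simp
  have RI: "integrable \<Omega> (\<lambda>\<omega>. R (mhat \<omega>))"
    using mhatI fin by (intro integrable_const_bound[of _ "Max ((\<lambda>m. \<bar>R m\<bar>) ` I)"] AE_I2) auto
  have \<xi>: "\<xi> i \<in> measurable \<Omega> P" if "i \<in> {1..n}" for i
    using ind that by (auto simp: indep_vars_def)
  \<comment> \<open>The selection rule enters through this comparison with \<open>m0\<close>. It
    holds almost surely, hence the inclusion of events up to null sets in the union bound.\<close>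
  have AEle: "AE \<omega> in \<Omega>. empirical_mean n \<xi> (f (mhat \<omega>)) \<omega> \<le> empirical_mean n \<xi> (f m0) \<omega>"
    using assms(17)
  proof eventually_elim
    case (elim \<omega>)
    show ?case unfolding elim by (rule cINF_lower) (use fin m0 in auto)
  qed
  \<comment> \<open>Real-valued deviation bound for a finite conjugate \<open>k\<close>, from which
    both claims are derived.\<close>
  have tail: "prob {\<omega>\<in>space \<Omega>. (1 + \<epsilon>) / (1 - \<epsilon>) * R m0
        + 1 / (1 - \<epsilon>) * (x + L) * (4 / \<epsilon> * k + 1 / (3 * n)) < R (mhat \<omega>)} \<le> exp (- x)"
    if \<epsilon>: "0 < \<epsilon>" "\<epsilon> < 1" and x: "0 < x" and k: "convex_conjugate \<phi> z = ereal k" for \<epsilon> x k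
  proof -
    define y where "y = x + L"
    have y: "0 < y" "1 \<le> 2 * y" using x L by (auto simp: y_def)
    define A where "A m = sqrt (integral\<^sup>L P (\<lambda>y. (f m y)\<^sup>2))" for m
    \<comment> \<open>Bernstein's threshold for \<open>f m0 - f m\<close> at level \<open>y\<close>:
      the mean \<open>R m0 - R m\<close>, then the deviation with Minkowski's bound
      \<open>A m0 + A m\<close> as \<open>\<sigma>\<close>.\<close>
    define thr where "thr m = R m0 - R m + ((A m0 + A m) * sqrt (2 * y / n) + y / (3 * n))" for m
    define E where "E m = {\<omega>\<in>space \<Omega>. empirical_mean n \<xi> (\<lambda>y. f m0 y - f m y) \<omega> \<ge> thr m}" for m
    have E_sets: "E m \<in> sets \<Omega>" if "m \<in> I" for m
    proof -
      have [measurable]: "empirical_mean n \<xi> (\<lambda>y. f m0 y - f m y) \<in> borel_measurable \<Omega>"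
        using fm m0 that \<xi> by (intro borel_measurable_empirical_mean[where P=P]) auto
      show ?thesis unfolding E_def by measurable
    qed
    have E_prob: "prob (E m) \<le> exp (- y)" if m: "m \<in> I" for m
    proof -
      have A0: "0 \<le> A m0 + A m" by (simp add: A_def)
      have "sqrt (\<integral>y. (f m0 y - f m y)\<^sup>2 \<partial>P) \<le> A m0 + A m"
        unfolding A_def using m m0 by (intro P.L2_norm_diff_le fm sqi)
      then have "(\<integral>y. (f m0 y - f m y)\<^sup>2 \<partial>P) \<le> (A m0 + A m)\<^sup>2" by (rule sqrt_le_D)
      from bernstein_empirical_mean[OF assms(1) n ind dist _ bd[OF m0(1) m] this A0 y(1)]
      show ?thesis using fm[OF m] fm[OF m0(1)] fi[OF m] fi[OF m0(1)]
        by (simp add: E_def thr_def R_def)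
    qed
    \<comment> \<open>Outside every \<open>E m\<close>, the empirical difference at the selected
      \<open>m\<close> is nonnegative and below \<open>thr m\<close>. So \<open>thr m\<close> is
      positive, and this alone contradicts a large \<open>R m\<close>.\<close>
    have sub: "\<omega> \<in> (\<Union>m\<in>I. E m)"
      if le: "empirical_mean n \<xi> (f (mhat \<omega>)) \<omega> \<le> empirical_mean n \<xi> (f m0) \<omega>"
        and bad: "\<omega> \<in> {\<omega>\<in>space \<Omega>. (1 + \<epsilon>) / (1 - \<epsilon>) * R m0
          + 1 / (1 - \<epsilon>) * (x + L) * (4 / \<epsilon> * k + 1 / (3 * n)) < R (mhat \<omega>)}" for \<omega>
    proof (rule ccontr)
      assume nE: "\<omega> \<notin> (\<Union>m\<in>I. E m)"
      from bad have \<omega>: "\<omega> \<in> space \<Omega>" and big: "(1 + \<epsilon>) / (1 - \<epsilon>) * R m0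
          + 1 / (1 - \<epsilon>) * y * (4 / \<epsilon> * k + 1 / (3 * n)) < R (mhat \<omega>)"
        by (auto simp: y_def)
      define m where "m = mhat \<omega>"
      have m: "m \<in> I" using mhatI[OF \<omega>] by (simp add: m_def)
      have "empirical_mean n \<xi> (\<lambda>y. f m0 y - f m y) \<omega>
          = empirical_mean n \<xi> (f m0) \<omega> - empirical_mean n \<xi> (f m) \<omega>"
        by (simp add: empirical_mean_def sum_subtractf diff_divide_distrib)
      with le nE m \<omega> have "0 < thr m" by (auto simp: E_def m_def)
      \<comment> \<open>\<open>|I| \<ge> 2\<close> enters here: it makes \<open>2 y \<ge> 1\<close>, hence \<open>\<theta> \<le> 1\<close>.\<close>
      define \<theta> where "\<theta> = \<epsilon> / sqrt (2 * y)"
      have \<theta>: "0 < \<theta>" "\<theta> \<le> 1"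
        using \<epsilon> y by (auto simp: \<theta>_def intro!: order_trans[of \<epsilon> 1 "sqrt (2 * y)"])
      \<comment> \<open>Since \<open>sqrt (2 * y / n) = sqrt (2 * y) * z\<close>, multiplying
        Young's inequality by \<open>sqrt (2 * y)\<close> turns the weights \<open>\<theta>\<close>
        and \<open>1 / \<theta>\<close> into \<open>\<epsilon>\<close> and
        \<open>2 * y / \<epsilon>\<close>.\<close>
      have young: "A m' * sqrt (2 * y / n) \<le> \<epsilon> * R m' + y * (2 / \<epsilon> * k)" if "m' \<in> I" for m'
      proof -
        have "A m' * z \<le> \<theta> * R m' + k / \<theta>"
          using \<phi>R[OF that] by (intro convex_conjugate_scaled_young[OF \<phi>0 mono _ _ k \<theta>]) (auto simp: A_def R_def)
        then have "sqrt (2 * y) * (A m' * z) \<le> sqrt (2 * y) * (\<theta> * R m' + k / \<theta>)"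
          using y by (intro mult_left_mono) auto
        also have "\<dots> = (sqrt (2 * y) * \<theta>) * R m' + (sqrt (2 * y) / \<theta>) * k"
          by (simp add: algebra_simps)
        also have "sqrt (2 * y) * \<theta> = \<epsilon>" using y by (simp add: \<theta>_def)
        also have "sqrt (2 * y) / \<theta> = 2 * y / \<epsilon>" using y by (simp add: \<theta>_def)
        finally show ?thesis using y by (simp add: z_def real_sqrt_divide mult_ac)
      qed
      \<comment> \<open>The two uses of \<open>young\<close> put \<open>\<epsilon>\<close> on both
        risks and double \<open>2 / \<epsilon>\<close> to \<open>4 / \<epsilon>\<close>; the term
        \<open>\<epsilon> * R m\<close> moves to the left.\<close>
      have "(1 - \<epsilon>) * R m < (1 + \<epsilon>) * R m0 + y * (4 / \<epsilon> * k + 1 / (3 * n))"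
        using \<open>0 < thr m\<close> young[OF m] young[OF m0(1)] by (simp add: thr_def algebra_simps)
      then have "R m < ((1 + \<epsilon>) * R m0 + y * (4 / \<epsilon> * k + 1 / (3 * n))) / (1 - \<epsilon>)"
        using \<epsilon> by (simp add: pos_less_divide_eq mult.commute)
      with big show False by (simp add: m_def add_divide_distrib[of "(1 + \<epsilon>) * R m0"])
    qed
    have "prob {\<omega>\<in>space \<Omega>. (1 + \<epsilon>) / (1 - \<epsilon>) * R m0
        + 1 / (1 - \<epsilon>) * (x + L) * (4 / \<epsilon> * k + 1 / (3 * n)) < R (mhat \<omega>)} \<le> prob (\<Union>m\<in>I. E m)" (is "prob ?B \<le> _")
    proof (rule finite_measure_mono_AE)
      show "AE \<omega> in \<Omega>. \<omega> \<in> ?B \<longrightarrow> \<omega> \<in> (\<Union>m\<in>I. E m)"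
        using AEle by eventually_elim (rule impI, rule sub)
      show "(\<Union>m\<in>I. E m) \<in> sets \<Omega>" using fin E_sets by (rule sets.finite_UN)
    qed
    also have "\<dots> \<le> (\<Sum>m\<in>I. prob (E m))"
      using fin E_sets by (intro finite_measure_subadditive_finite) auto
    also have "\<dots> \<le> card I * exp (- y)"
      using sum_bounded_above[of I "\<lambda>m. prob (E m)"] E_prob by simp
    \<comment> \<open>The shift of \<open>x\<close> by the logarithm of the cardinality in
      \<open>y\<close> pays for the union bound.\<close>
    also have "\<dots> = exp (- x)"
      using assms(4) by (simp add: y_def L_def exp_diff exp_minus field_simps exp_add)
    finally show ?thesis .
  qed
  have lnC: "ln (exp 1 * real (card I)) = 1 + L"
    using assms(4) by (simp add: L_def ln_mult)
  have Linf: "(INF m\<in>I. expectation (\<lambda>_. R m)) = R m0"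
    using m0 by (simp add: prob_space)
  \<comment> \<open>Either the conjugate is infinite and, as \<open>L > 0\<close>, both right-hand
    sides are infinite, or it is a real \<open>k\<close> and the claims reduce to real
    arithmetic.\<close>
  have conj: "convex_conjugate \<phi> z = \<infinity> \<or> (\<exists>k\<ge>0. convex_conjugate \<phi> z = ereal k)"
    using convex_conjugate_nonneg[of \<phi> z, OF \<phi>0] by (cases "convex_conjugate \<phi> z") auto
  have p1: "prob {\<omega>\<in>space \<Omega>. ereal ((1 + \<epsilon>) / (1 - \<epsilon>) * R m0) + ereal (1 / (1 - \<epsilon>) * (x + L))
      * (ereal (4 / \<epsilon>) * convex_conjugate \<phi> z + ereal (1 / (3 * real n))) < ereal (R (mhat \<omega>))} \<le> exp (- x)"
    if "0 < \<epsilon>" "\<epsilon> < 1" "0 < x" for \<epsilon> x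
    using conj
  proof (elim disjE exE conjE)
    assume "convex_conjugate \<phi> z = \<infinity>"
    then show ?thesis using that L by (simp add: zero_less_divide_iff)
  next
    fix k assume "convex_conjugate \<phi> z = ereal k"
    with tail[OF that this] show ?thesis by simp
  qed
  have p2: "ereal (expectation (\<lambda>\<omega>. R (mhat \<omega>))) \<le> ereal ((1 + \<epsilon>) / (1 - \<epsilon>) * R m0)
      + ereal (1 / (1 - \<epsilon>) * (1 + L)) * (ereal (4 / \<epsilon>) * convex_conjugate \<phi> z + ereal (1 / (3 * real n)))"
    if \<epsilon>: "0 < \<epsilon>" "\<epsilon> < 1" for \<epsilon>
    using conj
  proof (elim disjE exE conjE)
    assume "convex_conjugate \<phi> z = \<infinity>"
    then show ?thesis using \<epsilon> L by (simp add: zero_less_divide_iff)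
  next
    fix k assume k: "0 \<le> k" "convex_conjugate \<phi> z = ereal k"
    \<comment> \<open>The deviation threshold is the affine function \<open>c + (x + L) * b\<close>
      of \<open>x\<close>, so the rescaled variable \<open>(R (mhat \<omega>) - c) / b - L\<close>
      has tail at most \<open>exp (- x)\<close>. Its mean is at most 1, which yields the factor
      \<open>1 + L\<close>.\<close>
    define c b where "c = (1 + \<epsilon>) / (1 - \<epsilon>) * R m0" and "b = 1 / (1 - \<epsilon>) * (4 / \<epsilon> * k + 1 / (3 * n))"
    have b: "0 < b" using \<epsilon> k n by (auto simp: b_def intro!: add_nonneg_pos divide_pos_pos)
    have iff: "x < (R (mhat \<omega>) - c) / b - L \<longleftrightarrow>
        c + 1 / (1 - \<epsilon>) * (x + L) * (4 / \<epsilon> * k + 1 / (3 * n)) < R (mhat \<omega>)" for x \<omega>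
    proof -
      have "x < (R (mhat \<omega>) - c) / b - L \<longleftrightarrow> c + (x + L) * b < R (mhat \<omega>)"
        using b by (auto simp: less_diff_eq pos_less_divide_eq algebra_simps)
      then show ?thesis by (simp add: b_def mult_ac)
    qed
    have "expectation (\<lambda>\<omega>. (R (mhat \<omega>) - c) / b - L) \<le> 1"
      using RI tail[OF \<epsilon> _ k(2), folded c_def]
      by (intro expectation_le_1_of_exp_tail) (auto simp: iff)
    then have "(expectation (\<lambda>\<omega>. R (mhat \<omega>)) - c) / b - L \<le> 1"
      using RI by (simp add: prob_space)
    then have "expectation (\<lambda>\<omega>. R (mhat \<omega>)) \<le> c + (1 + L) * b"
      using b by (simp add: divide_le_eq diff_le_eq algebra_simps)
    then show ?thesis by (simp add: k(2) c_def b_def)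
  qed
  show ?thesis
    using p1 p2 unfolding lnC R_def[symmetric] z_def[symmetric] L_def[symmetric] m0(2) Linf by auto
qed

end
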